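(* Let $q$ be a prime power and let $s,t$ be positive integers satisfying $\gcd(4,s)=\gcd(4,t)=1$. Let $\gamma,\theta\in\mathbb F_{q^4}$ be such that $N_{q^4/q}(\gamma)$ and $N_{q^4/q}(\theta)$ are both non-squares in $\mathbb F_q$. The MRD code $\mathcal D_{2,s}(\gamma)$ is equivalent to $\mathcal D_{2,t}(\theta)$ if and only if one of the following collections of conditions is satisfied: (a) $s\equiv t\pmod 4$, and there exist $\sigma\in\mathrm{Aut}(\mathbb F_{q^4})$ and $h\in\mathbb F_{q^4}$ such that $\gamma^\sigma h^{q^{2s}-1}=\theta$. (b) $s\equiv t\pmod 4$, and there exist $c,d,g,h\in\mathbb F_{q^4}$, $\rho\in\mathrm{Aut}(\mathbb F_q)$ and $l\in\{0,1,2,3\}$ such that $$\begin{cases} cg^{q^{s+l}}-d^{q^2}h^{q^{s+l}}=0,\\ ch^{q^{s+l}}\theta^{q^2}-d^{q^2}g^{q^{s+l}}\theta=0,\\ cg^{q^l}+dh^{q^{l+2}}=0,\\ ch^{q^{2s+l}}\gamma^{\rho q^l}+dg^{q^l}\gamma^{\rho q^{l+2}}=0.\end{cases}$$ (c) $s\equiv -t\pmod 4$, and there exist $\sigma\in\mathrm{Aut}(\mathbb F_{q^4})$ and $h\in\mathbb F_{q^4}$ such that $\gamma^\sigma h^{q^{2s}-1}=1/\theta$. (d) $s\equiv -t\pmod 4$, and there exist $c,d,g,h\in\mathbb F_{q^4}$, $\rho\in\mathrm{Aut}(\mathbb F_q)$ and $l\in\{0,1,2,3\}$ such that $$\begin{cases}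 cg^{q^{s+l}}-d^{q^2}h^{q^{s+l}}=0,\\ ch^{q^{s+l}}\theta^{q^2}-d^{q^2}g^{q^{s+l}}\theta=0,\\ ch^{q^l}+dg^{q^{l+2}}=0,\\ cg^{q^{2s+l}}\gamma^{\rho q^l}+dh^{q^l}\gamma^{\rho q^{l+2}}=0.\end{cases}$$
   Context: $N_{q^4/q}$ denotes the norm from $\mathbb F_{q^4}$ to $\mathbb F_q$. A $q$-polynomial over $\mathbb F_{q^4}$ is a polynomial $\sum_i c_iX^{q^i}$ with $c_i\in\mathbb F_{q^4}$; $q$-polynomials are considered modulo $X^{q^4}-X$ (so the exponent $i$ in $X^{q^i}$ is read modulo $4$) and are identified with $\mathbb F_q$-linear maps of $\mathbb F_{q^4}$, i.e. with matrices in $\mathbb F_q^{4\times 4}$. A set $\mathcal C$ of such maps whose minimum distance (the minimum rank of $A-B$ over distinct $A,B\in\mathcal C$) is $d$ is an MRD (maximum rank-distance) code if $\#\mathcal C=q^{4(4-d+1)}$. For $s$ odd and $\gamma\in\mathbb F_{q^4}$ with $N_{q^4/q}(\gamma)$ a non-square in $\mathbb F_q$, define $$\mathcal D_{2,s}(\gamma)=\{aX+c_1X^{q^s}+\gamma bX^{q^{2s}} : c_1\in\mathbb F_{q^4},\ a,b\in\mathbb F_{q^2}\},$$ which is an MRD code. Two sets $\mathcal C_1,\mathcal C_2$ of $q$-polynomials over $\mathbb F_{q^4}$ are equivalent if there exist $q$-polynomials $\varphi_1,\varphi_2$ over $\mathbb F_{q^4}$ permuting $\mathbb F_{q^4}$,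 a $q$-polynomial $\psi$ over $\mathbb F_{q^4}$ and $\rho\in\mathrm{Aut}(\mathbb F_q)$ such that $\mathcal C_2=\{\varphi_1\circ f^\rho\circ\varphi_2+\psi: f\in\mathcal C_1\}$, where $f^\rho=\sum a_i^\rho X^{q^i}$ for $f=\sum a_iX^{q^i}$; here $\rho$, a power map $x\mapsto x^{p^e}$ with $p=\mathrm{char}\,\mathbb F_q$, is applied to elements of $\mathbb F_{q^4}$ by the same power map. For additive codes one may take $\psi=0$. The notation $\gamma^{\rho q^l}$ means $(\gamma^\rho)^{q^l}$. *)

theory Defs
  imports
    "HOL-Computational_Algebra.Computational_Algebra"
    "HOL-Library.Cardinality"
    "HOL-Number_Theory.Cong"
    "HOL-Number_Theory.Prime_Powers"
begin

text \<open>
  Throughout, the field with \<open>q\<^sup>4\<close> elements is a type \<open>'a\<close> of sort \<open>{field, finite}\<close> with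
  \<open>CARD('a) = q ^ 4\<close>, and for \<open>m\<close> dividing 4 its subfield with \<open>q\<^sup>m\<close> elements is the set of
  fixed points of \<open>x \<mapsto> x ^ (q ^ m)\<close>.
\<close>

definition fixed_field :: "nat \<Rightarrow> nat \<Rightarrow> 'a::field set" where
  "fixed_field q m = {x. x ^ (q ^ m) = x}"

text \<open>The relative norm from degree 4 down to the subfield with \<open>q\<close> elements.\<close>

definition norm4 :: "nat \<Rightarrow> 'a::field \<Rightarrow> 'a" where
  "norm4 q x = (\<Prod>i<4. x ^ (q ^ i))"

definition nonsquare_in :: "'a::field set \<Rightarrow> 'a \<Rightarrow> bool" where
  "nonsquare_in K x \<longleftrightarrow> x \<in> K \<and> \<not> (\<exists>y\<in>K. y ^ 2 = x)"

definition field_aut :: "('a::field \<Rightarrow> 'a) \<Rightarrow> bool" where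
  "field_aut \<sigma> \<longleftrightarrow> bij \<sigma> \<and> (\<forall>x y. \<sigma> (x + y) = \<sigma> x + \<sigma> y) \<and> (\<forall>x y. \<sigma> (x * y) = \<sigma> x * \<sigma> y)"

text \<open>
  The automorphisms of the field with \<open>q = p ^ r\<close> elements, each given as the power map
  \<open>x \<mapsto> x ^ (p ^ e)\<close> by which it acts on all of \<open>'a\<close>. The bound \<open>p ^ e < q\<close> says \<open>e < r\<close>, so that
  each of the \<open>r\<close> automorphisms occurs exactly once.
\<close>

definition base_auts :: "nat \<Rightarrow> ('a::field \<Rightarrow> 'a) set" where
  "base_auts q = {\<rho>. \<exists>e. CHAR('a) ^ e < q \<and> \<rho> = (\<lambda>x. x ^ (CHAR('a) ^ e))}"

text \<open>
  Residue classes modulo \<open>X ^ (q ^ 4) - X\<close> are represented by their remainders; the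
  \<open>q\<close>-polynomials among these are those with exponents \<open>q ^ i\<close>, \<open>i < 4\<close>.
\<close>

definition qreduce :: "nat \<Rightarrow> 'a::field poly \<Rightarrow> 'a poly" where
  "qreduce q f = f mod (monom 1 (q ^ 4) - monom 1 1)"

definition qpolys :: "nat \<Rightarrow> 'a::field poly set" where
  "qpolys q = {\<Sum>i<4. monom (c i) (q ^ i) | c. True}"

definition code_equiv :: "nat \<Rightarrow> 'a::field poly set \<Rightarrow> 'a poly set \<Rightarrow> bool" where
  "code_equiv q C1 C2 \<longleftrightarrow>
     (\<exists>\<phi>1\<in>qpolys q. \<exists>\<phi>2\<in>qpolys q. \<exists>\<psi>\<in>qpolys q. \<exists>\<rho>\<in>base_auts q.
        bij (poly \<phi>1) \<and> bij (poly \<phi>2) \<and>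
        C2 = {qreduce q (pcompose \<phi>1 (pcompose (map_poly \<rho> f) \<phi>2) + \<psi>) | f. f \<in> C1})"

definition code_D2 :: "nat \<Rightarrow> nat \<Rightarrow> 'a::field \<Rightarrow> 'a poly set" where
  "code_D2 q s \<gamma> =
     {qreduce q (monom a 1 + monom c1 (q ^ s) + monom (\<gamma> * b) (q ^ (2 * s))) | a b c1.
        a \<in> fixed_field q 2 \<and> b \<in> fixed_field q 2}"

end

theory Submission
  imports Defs
begin

text \<open>
  Write \<open>L\<close> for the field with \<open>q\<^sup>4\<close> elements, \<open>K\<close> for its subfield with \<open>q\<^sup>2\<close> elements, and
  \<open>S x = x ^ (q ^ s)\<close>, \<open>B x = x ^ (q\<^sup>2)\<close>. As \<open>s\<close> is odd, \<open>S\<close> generates the Galois group of \<open>L\<close>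
  over the field with \<open>q\<close> elements and \<open>B = S \<circ> S\<close> generates that of \<open>L\<close> over \<open>K\<close>. The theorem is
  true because both of its sides always hold: the codes \<open>D\<^bsub>2,s\<^esub>(\<gamma>)\<close> for all odd \<open>s\<close> and all \<open>\<gamma>\<close> of
  non-square norm are equivalent to each other, and the equations in (b) or (d) express one particular shape of equivalence, which always
  occurs.

  That shape is \<open>f \<mapsto> \<phi>\<^sub>1 \<circ> f \<circ> \<phi>\<^sub>2\<close> with \<open>\<phi>\<^sub>1 = c X + d B(X)\<close> and \<open>\<phi>\<^sub>2 = g S(B(X)) + h S(X)\<close>. An
  element of the code is \<open>f = a X + e S(X) + \<gamma> b B(X)\<close> with \<open>a, b \<in> K\<close> and \<open>e \<in> L\<close>. Since \<open>\<phi>\<^sub>2\<close>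
  has only odd powers of \<open>S\<close>, the map exchanges the two parts of the code: \<open>e S(X)\<close> turns into a
  combination of \<open>X\<close> and \<open>B(X)\<close>, while \<open>a X + \<gamma> b B(X)\<close> turns into a combination of \<open>S(X)\<close> and
  \<open>S(B(X))\<close>. The first two equations make the new coefficient of \<open>X\<close> a trace \<open>u + B u\<close>, and
  that of \<open>B(X)\<close> \<open>\<theta>\<close> times a trace, so that both are of the required form; this is
  \<open>composite_expansion\<close>. The last two equations kill one of the two odd coefficients: that of
  \<open>S(B(X))\<close> in (b), leaving an element of \<open>D\<^bsub>2,s\<^esub>(\<theta>)\<close>, and that of \<open>S(X)\<close> in (d), leaving an element
  of \<open>D\<^bsub>2,-s\<^esub>(\<theta>)\<close>. When \<open>\<phi>\<^sub>1\<close> and \<open>\<phi>\<^sub>2\<close> are bijective, the image is the whole target code, because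
  all codes have the same number of elements (\<open>code_equiv_D2\<close>).

  It remains to solve the equations with invertible \<open>\<phi>\<^sub>1\<close> and \<open>\<phi>\<^sub>2\<close> (\<open>linear_system_solution\<close>). An
  element with non-square norm is a non-square of \<open>L\<close>, so \<open>q\<close> is odd and the product of two such
  elements is a square. With \<open>m = (q\<^sup>2 - 1) / 2\<close> and \<open>\<tau> = S\<^sup>-\<^sup>1 \<theta>\<close>, this gives \<open>g\<close> with
  \<open>\<tau> g\<^sup>2 = \<gamma>\<close> and \<open>d\<close> with \<open>d\<^sup>2 = \<gamma> \<theta>\<close>; then \<open>h = g / \<tau>\<^sup>m\<close> and \<open>c = \<gamma>\<^sup>m d\<close> complete a solution of
  (b). For a non-square \<open>x\<close>, Euler's criterion says that the norm of \<open>x\<^sup>m\<close> from \<open>L\<close> to \<open>K\<close> is \<open>-1\<close>.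
  Hence the norms of \<open>c\<close> and \<open>d\<close> are opposite, as are those of \<open>g\<close> and \<open>h\<close>, which makes \<open>\<phi>\<^sub>1\<close> and
  \<open>\<phi>\<^sub>2\<close> injective. A solution \<open>(c, d, g, h)\<close> of (b) for \<open>1/\<theta>\<close> yields the solution
  \<open>(\<theta> c, \<theta> d, h, g)\<close> of (d) for \<open>\<theta>\<close>.
\<close>

section \<open>Composition with two binomials\<close>

text \<open>
  Only the formal properties of the Frobenius map enter into the shape of the composition, so it is
  computed for any ring endomorphism \<open>S\<close> with \<open>S\<^sup>4 = id\<close>.
\<close>

locale frobenius_of_order_four =
  fixes S :: "'a::field \<Rightarrow> 'a"
  assumes S_add: "S (x + y) = S x + S y"
    and S_mult: "S (x * y) = S x * S y"
    and S4: "S (S (S (S x))) = x"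
begin

text \<open>
  Of \<open>a, b, e\<close>, the coefficients of \<open>x\<close> and \<open>S (S x)\<close> involve only \<open>e\<close>; by the two equations each
  is, up to the factor \<open>\<theta>\<close> of the second, the trace of an element to the fixed field of \<open>S \<circ> S\<close>.
  The remaining two coefficients are combinations of \<open>a\<close> and \<open>b\<close>, so either of them vanishes for
  all \<open>a\<close> and \<open>b\<close> as soon as its two bracketed factors do.
\<close>

lemma composite_expansion:
  assumes e1: "c * S g = S (S d) * S h"
    and e2: "c * S h * S (S \<theta>) = S (S d) * S g * \<theta>"
    and "\<theta> \<noteq> 0"
    and a: "S (S a) = a" and b: "S (S b) = b"
  obtains a' b' where "S (S a') = a'" "S (S b') = b'"
    "\<And>x y. y = g * S (S (S x)) + h * S x \<Longrightarrow>
      c * (a * y + e * S y + \<gamma> * b * S (S y)) + d * S (S (a * y + e * S y + \<gamma> * b * S (S y)))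
      = a' * x + (a * (c * h + d * S (S g)) + b * (c * \<gamma> * S (S g) + d * S (S \<gamma>) * h)) * S x
        + \<theta> * b' * S (S x)
        + (a * (c * g + d * S (S h)) + b * (c * \<gamma> * S (S h) + d * S (S \<gamma>) * g)) * S (S (S x))"
proof -
  define a' where "a' = c * e * S g + d * S (S e) * S (S (S h))"
  define w where "w = c * e * S h + d * S (S e) * S (S (S g))"
  define b' where "b' = w / \<theta>"
  \<comment> \<open>Conjugating by \<open>S \<circ> S\<close> turns each summand of \<open>a'\<close> and of \<open>w / \<theta>\<close> into the other one.\<close>
  have e1': "S (S c) * S (S (S g)) = d * S (S (S h))"
    using arg_cong[OF e1, of "\<lambda>z. S (S z)"] by (simp add: S_mult S4)
  have e2': "S (S c) * S (S (S h)) * \<theta> = d * S (S (S g)) * S (S \<theta>)"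
    using arg_cong[OF e2, of "\<lambda>z. S (S z)"] by (simp add: S_mult S4)
  have S0: "S 0 = 0" using S_add[of 0 0] by (simp only: add_0_right add_cancel_right_right)
  have ne: "S (S \<theta>) \<noteq> 0" using S4[of \<theta>] S0 \<open>\<theta> \<noteq> 0\<close> by auto
  have wb: "w = \<theta> * b'" using \<open>\<theta> \<noteq> 0\<close> by (simp add: b'_def)
  have Ba: "S (S a') = a'"
  proof -
    have "S (S a') = S (S c) * S (S (S g)) * S (S e) + S (S d) * S h * e"
      by (simp add: a'_def S_add S_mult S4 algebra_simps)
    also have "\<dots> = a'" unfolding e1' e1[symmetric] by (simp add: a'_def algebra_simps)
    finally show ?thesis .
  qed
  have "S (S w) * \<theta> = S (S c) * S (S (S h)) * \<theta> * S (S e) + S (S d) * S g * \<theta> * e"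
    by (simp add: w_def S_add S_mult S4 algebra_simps)
  also have "\<dots> = w * S (S \<theta>)" unfolding e2' e2[symmetric] by (simp add: w_def algebra_simps)
  finally have "S (S b') * (S (S \<theta>) * \<theta>) = b' * (S (S \<theta>) * \<theta>)"
    by (simp add: wb S_mult ac_simps)
  then have Bb: "S (S b') = b'" using ne \<open>\<theta> \<noteq> 0\<close> by simp
  show thesis
    by (rule that[OF Ba Bb])
      (simp only: wb[symmetric] a'_def w_def a b S_add S_mult S4 algebra_simps)
qed

end

section \<open>The field with q to the power 4 elements\<close>

locale quartic_extension =
  fixes q :: nat and L :: "'a::{field,finite} itself"
  assumes primepow_q: "primepow q" and card_L: "CARD('a) = q ^ 4"
begin

lemma q_ge_2: "q \<ge> 2"
proof -
  obtain p r :: nat where "prime p" "r > 0" "q = p ^ r"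
    using primepow_q by (auto simp: primepow_def)
  then have "p \<le> q" by (metis prime_ge_1_nat self_le_power)
  with \<open>prime p\<close> show ?thesis using prime_ge_2_nat le_trans by blast
qed

text \<open>Multiplication by \<open>x\<close> permutes the non-zero elements and so fixes their product.\<close>

lemma power_pred_card:
  fixes x :: 'a
  assumes "x \<noteq> 0"
  shows "x ^ (q ^ 4 - 1) = 1"
proof -
  have "bij_betw ((*) x) (UNIV - {0}) (UNIV - {0})"
    by (rule bij_betwI[of _ _ _ "\<lambda>y. y / x"]) (use assms in auto)
  then have "\<Prod>(UNIV - {0::'a}) = (\<Prod>y\<in>UNIV - {0}. x * y)"
    by (simp add: prod.reindex_bij_betw[of "(*) x" _ _ "\<lambda>y. y", symmetric])
  also have "\<dots> = x ^ (q ^ 4 - 1) * \<Prod>(UNIV - {0})"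
    by (simp add: prod.distrib card_L)
  finally show ?thesis by simp
qed

lemma power_card: "(x :: 'a) ^ (q ^ 4) = x"
proof (cases "x = 0")
  case False
  have "x ^ (q ^ 4) = x ^ (q ^ 4 - 1) * x"
    using q_ge_2 by (metis power_minus_mult zero_less_power zero_less_numeral less_le_trans)
  with power_pred_card[OF False] show ?thesis by simp
qed (use q_ge_2 in auto)

lemma prime_char: "prime CHAR('a)"
  using prime_CHAR_semidom[where ?'a = 'a] finite_imp_CHAR_pos[where ?'a = 'a] by simp

lemma q_power_char: obtains r where "q = CHAR('a) ^ r"
proof -
  obtain p r where pr: "prime p" "r > 0" "q = p ^ r"
    using primepow_q by (auto simp: primepow_def)
  \<comment> \<open>Translation by 1 permutes the field, so it does not change the sum of all elements.\<close>
  have "(\<Sum>x\<in>(UNIV :: 'a set). x + 1) = \<Sum>UNIV"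
    by (rule sum.reindex_bij_witness[of _ "\<lambda>x. x - 1" "\<lambda>x. x + 1"]) auto
  then have "of_nat CARD('a) = (0 :: 'a)" by (simp add: sum.distrib)
  then have "CHAR('a) dvd p ^ (r * 4)"
    by (simp add: of_nat_eq_0_iff_char_dvd card_L pr(3) power_mult del: of_nat_power)
  then have "CHAR('a) = p"
    using prime_char pr(1) prime_dvd_power primes_dvd_imp_eq by blast
  with pr that show thesis by blast
qed

definition frob :: "nat \<Rightarrow> 'a \<Rightarrow> 'a" where "frob i x = x ^ (q ^ i)"

lemma frob_add: "frob i (x + y) = frob i x + frob i y"
proof -
  obtain r where "q = CHAR('a) ^ r" using q_power_char .
  then show ?thesis unfolding frob_def
    by (intro freshmans_dream'[OF prime_char, of _ "r * i"]) (simp add: power_mult)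
qed

lemma frob_mult: "frob i (x * y) = frob i x * frob i y"
  by (simp add: frob_def power_mult_distrib)

lemma frob_frob: "frob i (frob j x) = frob (i + j) x"
  by (simp add: frob_def power_add mult.commute flip: power_mult)

lemma frob_plus_4: "frob (i + 4) x = frob i x"
  by (simp add: frob_def power_add power_mult power_card mult.commute[of "q ^ i"])

lemma frob_mod: "frob (i mod 4) x = frob i x"
proof -
  have "frob (j + 4 * k) x = frob j x" for j k
  proof (induction k)
    case (Suc k)
    then show ?case using frob_plus_4[of "j + 4 * k" x] by (simp add: ac_simps)
  qed simp
  from this[of "i mod 4" "i div 4"] show ?thesis by simp
qed

lemma frob_cong: "[i = j] (mod 4) \<Longrightarrow> frob i x = frob j x"
  by (metis cong_def frob_mod)

section \<open>Polynomials as functions\<close>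

lemma poly_qreduce: "poly (qreduce q f) x = poly f (x :: 'a)"
proof -
  have "poly (monom 1 (q ^ 4) - monom 1 1) x = 0"
    by (simp add: poly_monom power_card)
  then show ?thesis
    unfolding qreduce_def by (metis poly_mod)
qed

lemma degree_qreduce: "degree (qreduce q (f :: 'a poly)) < q ^ 4"
proof -
  have "1 < q ^ 4" using q_ge_2 one_less_power[of q 4] by simp
  then have d: "degree (monom (1::'a) (q ^ 4) - monom 1 1) = q ^ 4"
    by (metis degree_add_eq_left degree_minus degree_monom_eq diff_conv_add_uminus zero_neq_one)
  then show ?thesis
    unfolding qreduce_def using degree_mod_less'[of "monom (1::'a) (q ^ 4) - monom 1 1" f]
    by (metis \<open>1 < q ^ 4\<close> degree_0 gr_implies_not0 zero_less_one order.strict_trans)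
qed

text \<open>Reduced polynomials may be identified with the functions on the field that they define.\<close>

lemma poly_function_inj:
  fixes f g :: "'a poly"
  assumes "degree f < q ^ 4" "degree g < q ^ 4" "poly f = poly g"
  shows "f = g"
  by (rule poly_eqI_degree[of UNIV]) (use assms card_L in auto)


section \<open>Squares and non-squares\<close>

text \<open>
  Half of the non-zero elements are squares, since squaring is at most two-to-one; all of these are
  roots of \<open>X\<^sup>M - 1\<close> with \<open>M = (q\<^sup>4 - 1) / 2\<close>, which has no further roots.
\<close>

lemma euler_square:
  fixes x :: 'a
  assumes "odd q" "x ^ ((q ^ 4 - 1) div 2) = 1"
  obtains y where "y ^ 2 = x"
proof -
  define M where "M = (q ^ 4 - 1) div 2"
  have M: "q ^ 4 - 1 = 2 * M" using \<open>odd q\<close> by (simp add: M_def)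
  have "M > 0"
  proof -
    have "2 ^ 4 \<le> q ^ 4" using q_ge_2 by (rule power_mono) simp
    with M show ?thesis by simp
  qed
  define A where "A = (\<lambda>y :: 'a. y ^ 2) ` (UNIV - {0})"
  define R where "R = {x :: 'a. x ^ M = 1}"
  have "R = {x. poly (monom 1 M - 1) x = 0}" by (simp add: R_def poly_monom)
  moreover have "degree (monom (1 :: 'a) M - 1) = M"
    using \<open>M > 0\<close> by (metis degree_1 degree_add_eq_left degree_minus degree_monom_eq
        diff_conv_add_uminus zero_neq_one)
  ultimately have cR: "card R \<le> M"
    using card_poly_roots_bound[of "monom (1 :: 'a) M - 1"] \<open>M > 0\<close> by fastforce
  have AR: "A \<subseteq> R"
  proof
    fix a assume "a \<in> A"
    then obtain y :: 'a where "y \<noteq> 0" "a = y ^ 2" by (auto simp: A_def)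
    with power_pred_card[of y] show "a \<in> R" unfolding M by (simp add: R_def power_mult)
  qed
  have fib: "card {y. y ^ 2 = a} \<le> 2" for a :: 'a
  proof (cases "\<exists>z. z ^ 2 = a")
    case True
    then obtain z where "z ^ 2 = a" by blast
    then have "{y. y ^ 2 = a} \<subseteq> {z, - z}" by (auto simp: power2_eq_iff)
    then have "card {y. y ^ 2 = a} \<le> card {z, - z}" by (intro card_mono) auto
    also have "\<dots> \<le> 2" by (simp add: card_insert_if)
    finally show ?thesis .
  qed auto
  have "2 * M = card (UNIV - {0 :: 'a})" using M by (simp add: card_L)
  also have "\<dots> \<le> card (\<Union>a\<in>A. {y. y ^ 2 = a})" by (intro card_mono) (auto simp: A_def)
  also have "\<dots> \<le> (\<Sum>a\<in>A. card {y. y ^ 2 = a})" by (intro card_UN_le) simp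
  also have "\<dots> \<le> 2 * card A"
    using sum_bounded_above[of A "\<lambda>a. card {y. y ^ 2 = a}" 2] fib by (simp add: mult.commute)
  finally have "card R \<le> card A" using cR by simp
  then have "A = R" by (intro card_seteq AR) auto
  moreover have "x \<in> R" using assms by (simp add: R_def M_def)
  ultimately show thesis using that by (auto simp: A_def)
qed

text \<open>If \<open>q\<close> is even, then \<open>x = x ^ (q\<^sup>4)\<close> is an even power of \<open>x\<close>.\<close>

lemma nonsquare_odd:
  assumes "\<nexists>y. y ^ 2 = (x :: 'a)"
  shows "odd q"
proof
  assume "even q"
  then obtain k where "q ^ 4 = k * 2" by (metis dvdE dvd_power mult.commute zero_less_numeral dvd_trans)
  then have "(x ^ k) ^ 2 = x" using power_card[of x] by (simp add: power_mult)
  with assms show False by blast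
qed

lemma nonsquare_euler:
  assumes "\<nexists>y. y ^ 2 = (x :: 'a)"
  shows "x ^ ((q ^ 4 - 1) div 2) = - 1" "(1 :: 'a) \<noteq> - 1"
proof -
  have odd: "odd q" using assms by (rule nonsquare_odd)
  have "x \<noteq> 0" using assms by (auto intro: power_zero_numeral)
  have "(x ^ ((q ^ 4 - 1) div 2)) ^ 2 = 1"
    using power_pred_card[OF \<open>x \<noteq> 0\<close>] odd by (simp flip: power_mult)
  moreover have n1: "x ^ ((q ^ 4 - 1) div 2) \<noteq> 1"
    using euler_square[OF odd] assms by blast
  ultimately show *: "x ^ ((q ^ 4 - 1) div 2) = - 1" by (simp add: power2_eq_1_iff)
  show "(1 :: 'a) \<noteq> - 1" using n1 * by metis
qed

lemma nonsquare_mult: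
  assumes "\<nexists>z. z ^ 2 = (x :: 'a)" "\<nexists>z. z ^ 2 = y"
  obtains w where "w ^ 2 = x * y"
  using euler_square[OF nonsquare_odd[OF assms(1)], of "x * y"]
    nonsquare_euler(1)[OF assms(1)] nonsquare_euler(1)[OF assms(2)]
  by (auto simp: power_mult_distrib)

text \<open>The norm is multiplicative with values in the base field, so it maps squares to squares.\<close>

lemma norm4_nonsquare:
  assumes "nonsquare_in (fixed_field q 1) (norm4 q x)"
  shows "\<nexists>y. y ^ 2 = (x :: 'a)"
proof
  assume "\<exists>y. y ^ 2 = x"
  then obtain y where y: "x = y ^ 2" by blast
  have "norm4 q x = norm4 q y ^ 2"
    unfolding norm4_def y prod_power_distrib by (simp add: mult.commute flip: power_mult)
  moreover have "norm4 q y ^ q = norm4 q y"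
    using power_card[of y]
    by (simp add: norm4_def numeral_eq_Suc power_mult_distrib mult_ac flip: power_mult)
  ultimately show False
    using assms by (auto simp: nonsquare_in_def fixed_field_def)
qed

section \<open>The Frobenius maps\<close>

lemma frob_power: "frob i (x ^ n) = frob i x ^ n"
  by (simp add: frob_def mult.commute flip: power_mult)

lemma frob_uminus: "frob i (- x) = - frob i x"
proof -
  have "frob i 0 = 0" using q_ge_2 by (simp add: frob_def)
  then show ?thesis using frob_add[of i x "- x"] by (simp add: eq_neg_iff_add_eq_0 add.commute)
qed

lemma frob_divide: "frob i (x / y) = frob i x / frob i y"
  by (simp add: frob_def power_divide)

lemma frob_eq_0: "frob i x = 0 \<longleftrightarrow> x = 0"
  using q_ge_2 by (simp add: frob_def)

lemma frob_0: "frob 0 x = x" by (simp add: frob_def)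

lemma frob_4: "frob 4 x = x" using frob_plus_4[of 0 x] by (simp add: frob_0)

lemma frob_odd_twice:
  assumes "odd s"
  shows "frob (s + s) x = frob 2 x"
proof (rule frob_cong)
  show "[s + s = 2] (mod 4)" using assms unfolding cong_def by presburger
qed

lemma frobenius_of_order_four_frob:
  assumes "odd s"
  shows "frobenius_of_order_four (frob s)"
proof
  show "frob s (frob s (frob s (frob s x))) = x" for x
  proof -
    have "frob s (frob s x) = frob 2 x" for x
      using frob_odd_twice[OF assms] by (simp add: frob_frob)
    then have "frob s (frob s (frob s (frob s x))) = frob 2 (frob 2 x)" by (simp only:)
    then show ?thesis by (simp add: frob_frob frob_4)
  qed
qed (simp_all add: frob_add frob_mult)

section \<open>Solving the equations\<close>

text \<open>
  Write \<open>S\<close>, \<open>B\<close> for \<open>frob s\<close>, \<open>frob 2\<close> and \<open>m = (q\<^sup>2 - 1) / 2\<close>. The last two equations ask for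
  \<open>c / d = - B h / g\<close> and \<open>(B h / g)\<^sup>2 = B \<gamma> / \<gamma> = (\<gamma>\<^sup>m)\<^sup>2\<close>, the first two for \<open>c / B d = S (h / g)\<close> and
  \<open>(S (h / g))\<^sup>2 = \<theta> / B \<theta> = (1 / \<theta>\<^sup>m)\<^sup>2\<close>. Choosing the square roots \<open>S (h / g) = 1 / \<theta>\<^sup>m\<close>, that is
  \<open>h / g = 1 / \<tau>\<^sup>m\<close> with \<open>S \<tau> = \<theta>\<close>, and \<open>B h / g = - \<gamma>\<^sup>m\<close> leaves the conditions
  \<open>(\<tau> g\<^sup>2)\<^sup>m = \<gamma>\<^sup>m\<close> on \<open>g\<close> and \<open>B d / d = (\<gamma> \<theta>)\<^sup>m\<close> on \<open>d\<close>. The two inequalities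
  say that norms to the subfield differ, which is what \<open>bij_binomial\<close> needs.
\<close>

lemma linear_system_solution:
  assumes "odd s" and \<gamma>: "\<nexists>y. y ^ 2 = \<gamma>" and \<theta>: "\<nexists>y. y ^ 2 = \<theta>"
  obtains c d g h where "c * frob 2 c \<noteq> d * frob 2 d" "g * frob 2 g \<noteq> h * frob 2 h"
    "c * frob s g = frob 2 d * frob s h"
    "c * frob s h * frob 2 \<theta> = frob 2 d * frob s g * \<theta>"
    "c * g + d * frob 2 h = 0"
    "c * frob 2 h * \<gamma> + d * g * frob 2 \<gamma> = 0"
proof -
  define m where "m = (q ^ 2 - 1) div 2"
  have "odd q" using \<gamma> by (rule nonsquare_odd)
  then have m: "q ^ 2 = 2 * m + 1" by (simp add: m_def)
  have "q ^ 4 = (q ^ 2) ^ 2" by (simp flip: power_mult)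
  then have M: "(q ^ 4 - 1) div 2 = m * (q ^ 2 + 1)"
    unfolding m by (simp add: power2_eq_square algebra_simps)
  have B: "frob 2 x = x * (x ^ m * x ^ m)" for x
    unfolding frob_def m by (simp add: power_add mult_2)
  have B': "frob 2 x = x * (x ^ 2) ^ m" for x
    unfolding frob_def m by (simp add: power_mult)
  have N: "x ^ m * frob 2 (x ^ m) = - 1" if "\<nexists>y. y ^ 2 = x" for x
  proof -
    have "x ^ m * frob 2 (x ^ m) = x ^ (m * (q ^ 2 + 1))"
      by (simp add: frob_def distrib_left power_add mult.commute flip: power_mult)
    then show ?thesis using nonsquare_euler(1)[OF that] unfolding M by simp
  qed
  define \<tau> where "\<tau> = frob (3 * s) \<theta>"
  have S\<tau>: "frob s \<tau> = \<theta>"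
  proof -
    have "[s + 3 * s = 0] (mod 4)" by (simp add: cong_def)
    then show ?thesis using frob_cong frob_0 by (simp add: \<tau>_def frob_frob)
  qed
  have \<tau>: "\<nexists>y. y ^ 2 = \<tau>"
    using \<theta> S\<tau> frob_power by metis
  define P G T where PGT: "P = \<tau> ^ m" "G = \<gamma> ^ m" "T = \<theta> ^ m"
  have SP: "frob s P = T" by (simp add: PGT frob_power S\<tau>)
  \<comment> \<open>\<open>P\<close>, \<open>G\<close> and \<open>T\<close> have norm \<open>-1\<close> over the subfield with \<open>q\<^sup>2\<close> elements.\<close>
  note NP = N[OF \<tau>, folded PGT] and NG = N[OF \<gamma>, folded PGT] and NT = N[OF \<theta>, folded PGT]
  have nz: "\<tau> \<noteq> 0" "P \<noteq> 0" "T \<noteq> 0" "\<gamma> \<noteq> 0" "\<theta> \<noteq> 0" "frob 2 P \<noteq> 0"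
    using \<tau> \<gamma> \<theta> NP NT by (auto intro: power_zero_numeral)
  obtain w where w: "w ^ 2 = \<tau> * \<gamma>" using nonsquare_mult[OF \<tau> \<gamma>] .
  define g where "g = w / \<tau>"
  have g: "\<tau> * g ^ 2 = \<gamma>" using nz by (simp add: g_def w power_divide power2_eq_square[of \<tau>])
  obtain d where d: "d ^ 2 = \<gamma> * \<theta>" using nonsquare_mult[OF \<gamma> \<theta>] .
  have nz': "g \<noteq> 0" "d \<noteq> 0" using g d nz by auto
  define h where "h = g / P"
  define c where "c = G * d"
  have BP: "frob 2 P = - 1 / P" using NP nz by (simp add: field_simps)
  have "P * (g ^ 2) ^ m = G" unfolding PGT g[symmetric] by (simp add: power_mult_distrib)
  then have Bh: "frob 2 h = - (g * G)"
    by (simp add: h_def frob_divide BP B'[of g] mult_ac)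
  have Bd: "frob 2 d = d * G * T" by (simp add: B' d PGT power_mult_distrib)
  have Sh: "frob s h = frob s g / T" by (simp add: h_def frob_divide SP)
  show thesis
  proof (rule that)
    have neg: "x \<noteq> - x" if "x \<noteq> 0" for x :: 'a
      using nonsquare_euler(2)[OF \<gamma>] that
      by (metis minus_equation_iff mult_cancel_left mult_minus_right mult.right_neutral)
    have "c * frob 2 c = (G * frob 2 G) * (d * frob 2 d)"
      by (simp add: c_def frob_mult mult_ac)
    then show "c * frob 2 c \<noteq> d * frob 2 d"
      using neg[of "d * frob 2 d"] nz' by (simp add: NG frob_eq_0)
    have "h * frob 2 h = g * frob 2 g / (P * frob 2 P)"
      by (simp add: h_def frob_divide)
    then show "g * frob 2 g \<noteq> h * frob 2 h"
      using neg[of "g * frob 2 g"] nz' by (simp add: NP frob_eq_0)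
    show "c * frob s g = frob 2 d * frob s h"
      using nz by (simp add: c_def Bd Sh)
    show "c * frob s h * frob 2 \<theta> = frob 2 d * frob s g * \<theta>"
      using nz by (simp add: c_def Bd Sh B[of \<theta>] flip: PGT)
    show "c * g + d * frob 2 h = 0" by (simp add: c_def Bh)
    show "c * frob 2 h * \<gamma> + d * g * frob 2 \<gamma> = 0"
      by (simp add: c_def Bh B[of \<gamma>] flip: PGT)
  qed
qed

section \<open>Binomials and a criterion for equivalence\<close>

text \<open>
  A non-zero \<open>z\<close> in the kernel of \<open>c X + d B(X)\<close> satisfies \<open>c z = - d B z\<close>; taking norms to the
  subfield fixed by \<open>B\<close> and cancelling the norm of \<open>z\<close> gives equal norms of \<open>c\<close> and \<open>d\<close>.
\<close>

lemma bij_binomial: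
  assumes "c * frob 2 c \<noteq> d * frob 2 d"
  shows "bij (\<lambda>x. c * frob i x + d * frob (i + 2) x)"
proof -
  have "inj (\<lambda>x. c * frob i x + d * frob (i + 2) x)"
  proof (rule injI)
    fix x y assume eq: "c * frob i x + d * frob (i + 2) x = c * frob i y + d * frob (i + 2) y"
    define z where "z = frob i (x - y)"
    have z: "z = frob i x - frob i y"
      unfolding z_def using frob_add[of i x "- y"] by (simp add: frob_uminus)
    have Bz: "frob 2 z = frob (i + 2) x - frob (i + 2) y"
      unfolding z using frob_add[of 2 "frob i x" "- frob i y"]
      by (simp add: frob_uminus frob_frob add.commute)
    have cz: "c * z = - (d * frob 2 z)"
      using eq unfolding Bz unfolding z by (simp add: algebra_simps)
    have "c * frob 2 c * (z * frob 2 z) = (c * z) * frob 2 (c * z)"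
      by (simp add: frob_mult mult_ac)
    also have "\<dots> = d * frob 2 d * (z * frob 2 z)"
      unfolding cz by (simp add: frob_uminus frob_mult frob_frob frob_4 mult_ac)
    finally have "z = 0" using assms by (simp add: frob_eq_0)
    then show "x = y" by (simp add: z_def frob_eq_0)
  qed
  then show ?thesis by (simp add: bij_def finite_UNIV_inj_surj)
qed

lemma binomial_qpoly:
  "\<exists>\<phi>\<in>qpolys q. \<forall>x. poly \<phi> x = c * frob i x + d * frob j x"
proof -
  define e where "e k = (if k = i mod 4 then c else 0) + (if k = j mod 4 then d else 0)" for k
  define \<phi> where "\<phi> = (\<Sum>k<4. monom (e k) (q ^ k))"
  have "\<phi> \<in> qpolys q" by (auto simp: qpolys_def \<phi>_def)
  moreover have "poly \<phi> x = c * frob i x + d * frob j x" for x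
  proof -
    have "poly \<phi> x = (\<Sum>k<4. (if k = i mod 4 then c * frob k x else 0)
        + (if k = j mod 4 then d * frob k x else 0))"
      unfolding \<phi>_def poly_sum
      by (intro sum.cong) (auto simp: e_def poly_monom frob_def distrib_right)
    then show ?thesis by (simp add: sum.distrib frob_mod)
  qed
  ultimately show ?thesis by blast
qed

text \<open>
  An injective map between finite sets of the same size is onto, so only one inclusion has to be
  checked, and only for values.
\<close>

lemma code_equivI:
  assumes \<phi>: "\<phi>1 \<in> qpolys q" "\<phi>2 \<in> qpolys q" "bij (poly \<phi>1)" "bij (poly \<phi>2)"
    and deg: "\<And>f. f \<in> C1 \<union> C2 \<Longrightarrow> degree f < q ^ 4"
    and card: "finite C2" "card C1 = card C2"
    and maps: "\<And>f. f \<in> C1 \<Longrightarrow> \<exists>f'\<in>C2. \<forall>x. poly \<phi>1 (poly f (poly \<phi>2 x)) = poly f' (x :: 'a)"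
  shows "code_equiv q C1 C2"
proof -
  define \<rho> :: "'a \<Rightarrow> 'a" where "\<rho> = (\<lambda>x. x ^ (CHAR('a) ^ 0))"
  have \<rho>: "\<rho> \<in> base_auts q" using q_ge_2 by (auto simp: base_auts_def \<rho>_def intro!: exI[of _ 0])
  define tr where "tr f = qreduce q (pcompose \<phi>1 (pcompose (map_poly \<rho> f) \<phi>2) + 0)" for f
  have poly_tr: "poly (tr f) x = poly \<phi>1 (poly f (poly \<phi>2 x))" for f x
    by (simp add: tr_def poly_qreduce poly_pcompose \<rho>_def map_poly_id')
  have "inj_on tr C1"
  proof (rule inj_onI)
    fix f f' assume f: "f \<in> C1" "f' \<in> C1" "tr f = tr f'"
    have "poly f x = poly f' x" for x
    proof -
      obtain y where "x = poly \<phi>2 y" using \<phi>(4) by (meson bij_pointE)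
      with f(3) poly_tr[of f y] poly_tr[of f' y] \<phi>(3) show ?thesis
        by (metis bij_def injD)
    qed
    with deg f show "f = f'" by (intro poly_function_inj) auto
  qed
  moreover have "tr ` C1 \<subseteq> C2"
  proof
    fix p assume "p \<in> tr ` C1"
    then obtain f where f: "f \<in> C1" "p = tr f" by blast
    obtain f' where f': "f' \<in> C2" "\<forall>x. poly p x = poly f' x"
      using maps[OF f(1)] by (auto simp: f(2) poly_tr)
    have "p = f'" using f' deg by (intro poly_function_inj) (auto simp: f(2) tr_def degree_qreduce)
    with f' show "p \<in> C2" by simp
  qed
  ultimately have "C2 = tr ` C1"
    using card by (metis card_image card_subset_eq)
  moreover have "0 \<in> qpolys q"
    unfolding qpolys_def by (rule CollectI, rule exI[of _ "\<lambda>_. 0"]) simp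
  ultimately show ?thesis
    unfolding code_equiv_def using \<phi> \<rho>
    by (intro bexI[of _ \<phi>1] bexI[of _ \<phi>2] bexI[of _ 0] bexI[of _ \<rho>]) (auto simp: tr_def)
qed

section \<open>Equivalence of the codes\<close>

definition trinomial :: "nat \<Rightarrow> 'a \<Rightarrow> 'a \<times> 'a \<times> 'a \<Rightarrow> 'a poly" where
  "trinomial s \<gamma> = (\<lambda>(a, b, e).
     qreduce q (monom a 1 + monom e (q ^ s) + monom (\<gamma> * b) (q ^ (2 * s))))"

lemma code_D2_image: "code_D2 q s \<gamma> = trinomial s \<gamma> ` (fixed_field q 2 \<times> fixed_field q 2 \<times> UNIV)"
  unfolding code_D2_def trinomial_def by (auto simp: image_iff) blast+

lemma poly_trinomial:
  assumes "odd s"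
  shows "poly (trinomial s \<gamma> (a, b, e)) x = a * x + e * frob s x + \<gamma> * b * frob 2 x"
proof -
  have "x ^ (q ^ (2 * s)) = frob 2 x"
    using frob_odd_twice[OF assms, of x] by (simp add: frob_def mult_2)
  then show ?thesis
    by (simp add: trinomial_def poly_qreduce poly_monom) (simp add: frob_def)
qed

text \<open>
  The parametrisation of the code by \<open>(a, b, e)\<close> is faithful, because the exponents \<open>1\<close>, \<open>q ^ s\<close>
  and \<open>q\<^sup>2\<close> stay distinct after reduction. So all
  these codes have the same size.
\<close>

lemma inj_trinomial:
  assumes "odd s" "\<gamma> \<noteq> 0"
  shows "inj (trinomial s \<gamma>)"
proof (rule injI)
  fix u v assume uv: "trinomial s \<gamma> u = trinomial s \<gamma> v"
  obtain a b e a' b' e' where def: "u = (a, b, e)" "v = (a', b', e')" by (cases u, cases v) auto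
  note eq = uv[unfolded def]
  define r where "r = s mod 4"
  have r: "r = 1 \<or> r = 3" using \<open>odd s\<close> unfolding r_def by presburger
  define p where "p = monom (a - a') 1 + monom (e - e') (q ^ r) + monom (\<gamma> * (b - b')) (q ^ 2)"
  have pw: "1 < q ^ r" "1 < q ^ 2" "q ^ r < q ^ 4" "q ^ 2 < q ^ 4" "q ^ r \<noteq> q ^ 2"
    using q_ge_2 r one_less_power[of q 3] one_less_power[of q 2] by auto
  have "degree p < q ^ 4"
    unfolding p_def by (intro degree_add_less le_less_trans[OF degree_monom_le]) (use pw in auto)
  moreover have "poly p x = poly 0 x" for x
    using arg_cong[OF eq, of "\<lambda>p. poly p x"] frob_mod[of s x]
    by (simp add: p_def poly_trinomial[OF \<open>odd s\<close>] poly_monom r_def)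
       (simp add: frob_def algebra_simps)
  ultimately have "p = 0" using q_ge_2 by (intro poly_function_inj) auto
  then have "coeff p 1 = 0" "coeff p (q ^ r) = 0" "coeff p (q ^ 2) = 0" by simp_all
  then show "u = v"
    using pw r q_ge_2 \<open>\<gamma> \<noteq> 0\<close> by (auto simp: p_def def)
qed

text \<open>
  This is the reason for the systems of equations in (b) and (d), taken with \<open>\<rho>\<close> the identity and
  \<open>l = 0\<close>: the two alternatives say which of the two odd coefficients in \<open>composite_expansion\<close>
  vanishes for all \<open>a\<close> and \<open>b\<close>.
\<close>

lemma code_equiv_D2:
  assumes "odd s" "odd t" "\<gamma> \<noteq> 0" "\<theta> \<noteq> 0"
    and inv: "c * frob 2 c \<noteq> d * frob 2 d" "g * frob 2 g \<noteq> h * frob 2 h"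
    and e1: "c * frob s g = frob 2 d * frob s h"
    and e2: "c * frob s h * frob 2 \<theta> = frob 2 d * frob s g * \<theta>"
    and st: "[s = t] (mod 4) \<and> c * g + d * frob 2 h = 0 \<and> c * frob 2 h * \<gamma> + d * g * frob 2 \<gamma> = 0
      \<or> [3 * s = t] (mod 4) \<and> c * h + d * frob 2 g = 0 \<and> c * frob 2 g * \<gamma> + d * h * frob 2 \<gamma> = 0"
  shows "code_equiv q (code_D2 q s \<gamma>) (code_D2 q t \<theta>)"
proof -
  interpret frobenius_of_order_four "frob s" using \<open>odd s\<close> by (rule frobenius_of_order_four_frob)
  have SS: "frob s (frob s x) = frob 2 x" for x
    by (simp add: frob_frob frob_odd_twice[OF \<open>odd s\<close>])
  have S3: "frob s (frob 2 x) = frob (3 * s) x" for x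
  proof -
    have "frob s (frob s (frob s x)) = frob (3 * s) x" by (simp add: frob_frob numeral_3_eq_3 add.assoc)
    then show ?thesis by (simp add: SS)
  qed
  obtain \<phi>1 where \<phi>1: "\<phi>1 \<in> qpolys q" "\<And>x. poly \<phi>1 x = c * frob 0 x + d * frob (0 + 2) x"
    using binomial_qpoly[of c 0 d "0 + 2"] by blast
  obtain \<phi>2 where \<phi>2: "\<phi>2 \<in> qpolys q" "\<And>x. poly \<phi>2 x = h * frob s x + g * frob (s + 2) x"
    using binomial_qpoly[of h s g "s + 2"] by blast
  show ?thesis
  proof (rule code_equivI)
    show "bij (poly \<phi>1)" unfolding \<phi>1(2) using inv(1) by (rule bij_binomial)
    show "bij (poly \<phi>2)" unfolding \<phi>2(2) using inv(2)[symmetric] by (rule bij_binomial)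
    show "card (code_D2 q s \<gamma>) = card (code_D2 q t \<theta>)"
      using inj_trinomial[of s \<gamma>] inj_trinomial[of t \<theta>] assms(1-4)
      by (simp add: code_D2_image card_image[OF inj_on_subset])
    fix f assume "f \<in> code_D2 q s \<gamma>"
    then obtain a b e where f: "f = trinomial s \<gamma> (a, b, e)"
      and ab: "frob s (frob s a) = a" "frob s (frob s b) = b"
      by (auto simp: code_D2_image fixed_field_def SS) (simp add: frob_def)
    obtain a' b' where ab': "frob 2 a' = a'" "frob 2 b' = b'" and exp:
      "\<And>x y. y = g * frob (3 * s) x + h * frob s x \<Longrightarrow>
        c * (a * y + e * frob s y + \<gamma> * b * frob 2 y) + d * frob 2 (a * y + e * frob s y + \<gamma> * b * frob 2 y)
      = a' * x + (a * (c * h + d * frob 2 g) + b * (c * \<gamma> * frob 2 g + d * frob 2 \<gamma> * h)) * frob s x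
        + \<theta> * b' * frob 2 x
        + (a * (c * g + d * frob 2 h) + b * (c * \<gamma> * frob 2 h + d * frob 2 \<gamma> * g)) * frob (3 * s) x"
      using composite_expansion[of c g d h \<theta> a b e \<gamma>] e1 e2 \<open>\<theta> \<noteq> 0\<close> ab unfolding SS S3 by blast
    have comp: "poly \<phi>1 (poly f (poly \<phi>2 x))
      = a' * x + (a * (c * h + d * frob 2 g) + b * (c * \<gamma> * frob 2 g + d * frob 2 \<gamma> * h)) * frob s x
        + \<theta> * b' * frob 2 x
        + (a * (c * g + d * frob 2 h) + b * (c * \<gamma> * frob 2 h + d * frob 2 \<gamma> * g)) * frob (3 * s) x" for x
    proof -
      have "poly \<phi>2 x = g * frob (3 * s) x + h * frob s x"
        by (simp add: \<phi>2(2) frob_frob flip: S3)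
      from exp[OF this] show ?thesis
        by (simp add: \<phi>1(2)[unfolded add_0 frob_0] f poly_trinomial[OF \<open>odd s\<close>])
    qed
    have "\<exists>e'. \<forall>x. poly \<phi>1 (poly f (poly \<phi>2 x)) = a' * x + e' * frob t x + \<theta> * b' * frob 2 x"
      using st
    proof (elim disjE conjE)
      assume "[s = t] (mod 4)" and z: "c * g + d * frob 2 h = 0" "c * frob 2 h * \<gamma> + d * g * frob 2 \<gamma> = 0"
      have z2: "c * \<gamma> * frob 2 h + d * frob 2 \<gamma> * g = 0" using z(2) by (simp add: mult_ac)
      show ?thesis unfolding comp z(1) z2 frob_cong[OF \<open>[s = t] (mod 4)\<close>]
        by (rule exI[of _ "a * (c * h + d * frob 2 g) + b * (c * \<gamma> * frob 2 g + d * frob 2 \<gamma> * h)"])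
          (simp add: add_ac)
    next
      assume "[3 * s = t] (mod 4)" and z: "c * h + d * frob 2 g = 0" "c * frob 2 g * \<gamma> + d * h * frob 2 \<gamma> = 0"
      have z2: "c * \<gamma> * frob 2 g + d * frob 2 \<gamma> * h = 0" using z(2) by (simp add: mult_ac)
      show ?thesis unfolding comp z(1) z2 frob_cong[OF \<open>[3 * s = t] (mod 4)\<close>]
        by (rule exI[of _ "a * (c * g + d * frob 2 h) + b * (c * \<gamma> * frob 2 h + d * frob 2 \<gamma> * g)"])
          (simp add: add_ac)
    qed
    then obtain e' where "\<And>x. poly \<phi>1 (poly f (poly \<phi>2 x)) = poly (trinomial t \<theta> (a', b', e')) x"
      by (auto simp: poly_trinomial[OF \<open>odd t\<close>])
    moreover have "trinomial t \<theta> (a', b', e') \<in> code_D2 q t \<theta>"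
      using ab' by (simp add: code_D2_image fixed_field_def frob_def)
    ultimately show "\<exists>f'\<in>code_D2 q t \<theta>. \<forall>x. poly \<phi>1 (poly f (poly \<phi>2 x)) = poly f' x" by blast
  qed (auto simp: \<phi>1 \<phi>2 code_D2_image trinomial_def degree_qreduce)
qed

end

theorem theorem12:
  fixes q s t :: nat and \<gamma> \<theta> :: "'a::{field,finite}"
  assumes "primepow q"
    and "CARD('a) = q ^ 4"
    and "s > 0" and "t > 0"
    and "gcd 4 s = 1" and "gcd 4 t = 1"
    and "nonsquare_in (fixed_field q 1) (norm4 q \<gamma>)"
    and "nonsquare_in (fixed_field q 1) (norm4 q \<theta>)"
  shows "code_equiv q (code_D2 q s \<gamma>) (code_D2 q t \<theta>) \<longleftrightarrow>
    ([s = t] (mod 4) \<and>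
      (\<exists>\<sigma> h. field_aut \<sigma> \<and> \<sigma> \<gamma> * h ^ (q ^ (2 * s) - 1) = \<theta>))
    \<or> ([s = t] (mod 4) \<and>
      (\<exists>c d g h. \<exists>\<rho>\<in>base_auts q. \<exists>l\<in>{0, 1, 2, 3}.
        c * g ^ (q ^ (s + l)) - d ^ (q ^ 2) * h ^ (q ^ (s + l)) = 0 \<and>
        c * h ^ (q ^ (s + l)) * \<theta> ^ (q ^ 2) - d ^ (q ^ 2) * g ^ (q ^ (s + l)) * \<theta> = 0 \<and>
        c * g ^ (q ^ l) + d * h ^ (q ^ (l + 2)) = 0 \<and>
        c * h ^ (q ^ (2 * s + l)) * \<rho> \<gamma> ^ (q ^ l) + d * g ^ (q ^ l) * \<rho> \<gamma> ^ (q ^ (l + 2)) = 0))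
    \<or> ([int s = - int t] (mod 4) \<and>
      (\<exists>\<sigma> h. field_aut \<sigma> \<and> \<sigma> \<gamma> * h ^ (q ^ (2 * s) - 1) = 1 / \<theta>))
    \<or> ([int s = - int t] (mod 4) \<and>
      (\<exists>c d g h. \<exists>\<rho>\<in>base_auts q. \<exists>l\<in>{0, 1, 2, 3}.
        c * g ^ (q ^ (s + l)) - d ^ (q ^ 2) * h ^ (q ^ (s + l)) = 0 \<and>
        c * h ^ (q ^ (s + l)) * \<theta> ^ (q ^ 2) - d ^ (q ^ 2) * g ^ (q ^ (s + l)) * \<theta> = 0 \<and>
        c * h ^ (q ^ l) + d * g ^ (q ^ (l + 2)) = 0 \<and>
        c * g ^ (q ^ (2 * s + l)) * \<rho> \<gamma> ^ (q ^ l) + d * h ^ (q ^ l) * \<rho> \<gamma> ^ (q ^ (l + 2)) = 0))"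
proof -
  interpret quartic_extension q "TYPE('a)"
    using assms(1,2) by unfold_locales
  have odd: "odd s" "odd t"
    using assms(5,6) gcd_greatest_iff[of 2 4 s] gcd_greatest_iff[of 2 4 t] by auto
  have \<gamma>: "\<nexists>y. y ^ 2 = \<gamma>" and \<theta>: "\<nexists>y. y ^ 2 = \<theta>"
    using assms(7,8) by (simp_all add: norm4_nonsquare)
  then have nz: "\<gamma> \<noteq> 0" "\<theta> \<noteq> 0" by (auto intro: power_zero_numeral)
  have B: "x ^ (q ^ (2 * s)) = frob 2 x" for x :: 'a
    using frob_odd_twice[OF odd(1), of x] by (simp add: frob_def mult_2)
  have id: "(\<lambda>x :: 'a. x) \<in> base_auts q"
    using q_ge_2 by (auto simp: base_auts_def intro!: exI[of _ 0])
  consider (same) "[s = t] (mod 4)"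
    | (opp) "[int s = - int t] (mod 4)" "[3 * s = t] (mod 4)"
  proof (cases "[s = t] (mod 4)")
    case False
    then have "s mod 4 = 1 \<and> t mod 4 = 3 \<or> s mod 4 = 3 \<and> t mod 4 = 1"
      using odd unfolding cong_def by presburger
    then have "4 dvd s + t" "3 * s mod 4 = t mod 4" by presburger+
    moreover from this(1) have "int 4 dvd int (s + t)" by (simp only: int_dvd_int_iff)
    ultimately have "[int s = - int t] (mod 4)" "[3 * s = t] (mod 4)"
      by (simp_all add: cong_iff_dvd_diff cong_def[of "3 * s"])
    then show thesis by (rule opp)
  qed (rule same)
  then show ?thesis
  proof cases
    case same
    obtain c d g h where "c * frob 2 c \<noteq> d * frob 2 d" "g * frob 2 g \<noteq> h * frob 2 h"
      and sys: "c * frob s g = frob 2 d * frob s h"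
        "c * frob s h * frob 2 \<theta> = frob 2 d * frob s g * \<theta>"
        "c * g + d * frob 2 h = 0"
        "c * frob 2 h * \<gamma> + d * g * frob 2 \<gamma> = 0"
      using linear_system_solution[OF odd(1) \<gamma> \<theta>] .
    then have equiv: "code_equiv q (code_D2 q s \<gamma>) (code_D2 q t \<theta>)"
      using same odd nz by (intro code_equiv_D2) auto
    have sol: "c * g ^ (q ^ (s + 0)) - d ^ (q ^ 2) * h ^ (q ^ (s + 0)) = 0 \<and>
        c * h ^ (q ^ (s + 0)) * \<theta> ^ (q ^ 2) - d ^ (q ^ 2) * g ^ (q ^ (s + 0)) * \<theta> = 0 \<and>
        c * g ^ (q ^ 0) + d * h ^ (q ^ (0 + 2)) = 0 \<and>
        c * h ^ (q ^ (2 * s + 0)) * \<gamma> ^ (q ^ 0) + d * g ^ (q ^ 0) * \<gamma> ^ (q ^ (0 + 2)) = 0"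
      using sys by (simp add: B) (simp add: frob_def power2_eq_square)
    show ?thesis
      by (rule iffI[OF _ equiv], rule disjI2, rule disjI1, rule conjI[OF same],
          rule exI[of _ c], rule exI[of _ d], rule exI[of _ g], rule exI[of _ h],
          rule bexI[OF _ id], rule bexI[of _ 0], rule sol) simp
  next
    case opp
    have "\<nexists>y. y ^ 2 = 1 / \<theta>"
    proof
      assume "\<exists>y. y ^ 2 = 1 / \<theta>"
      then obtain y where "y ^ 2 = 1 / \<theta>" ..
      then have "(1 / y) ^ 2 = \<theta>" by (simp add: power_divide)
      with \<theta> show False by blast
    qed
    then obtain c d h g where inv: "c * frob 2 c \<noteq> d * frob 2 d" "h * frob 2 h \<noteq> g * frob 2 g"
      and sys: "c * frob s h = frob 2 d * frob s g"
        "c * frob s g * frob 2 (1 / \<theta>) = frob 2 d * frob s h * (1 / \<theta>)"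
        "c * h + d * frob 2 g = 0"
        "c * frob 2 g * \<gamma> + d * h * frob 2 \<gamma> = 0"
      using linear_system_solution[OF odd(1) \<gamma>] by blast
    \<comment> \<open>Exchanging \<open>g\<close> and \<open>h\<close> exchanges the two odd coefficients. It also replaces \<open>\<theta>\<close> by \<open>1/\<theta>\<close> in
      the condition on the even ones, up to a left factor \<open>\<theta>\<close>.\<close>
    define c' d' where cd: "c' = \<theta> * c" "d' = \<theta> * d"
    have nzB: "frob 2 \<theta> \<noteq> 0" using nz by (simp add: frob_eq_0)
    have inv': "c' * frob 2 c' \<noteq> d' * frob 2 d'" "g * frob 2 g \<noteq> h * frob 2 h"
      using inv nz nzB by (auto simp: cd frob_mult mult_ac)
    have e1: "c' * frob s g = frob 2 d' * frob s h"
      using sys(2) nz nzB by (simp add: cd frob_mult frob_divide field_simps frob_def)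
    have e2: "c' * frob s h * frob 2 \<theta> = frob 2 d' * frob s g * \<theta>"
      using sys(1) by (simp add: cd frob_mult mult_ac)
    have e3: "c' * h + d' * frob 2 g = 0"
      using arg_cong[OF sys(3), of "(*) \<theta>"] by (simp add: cd algebra_simps)
    have e4: "c' * frob 2 g * \<gamma> + d' * h * frob 2 \<gamma> = 0"
      using arg_cong[OF sys(4), of "(*) \<theta>"] by (simp add: cd algebra_simps)
    have equiv: "code_equiv q (code_D2 q s \<gamma>) (code_D2 q t \<theta>)"
      by (rule code_equiv_D2[OF odd nz inv' e1 e2]) (use opp e3 e4 in blast)
    have sol: "c' * g ^ (q ^ (s + 0)) - d' ^ (q ^ 2) * h ^ (q ^ (s + 0)) = 0 \<and>
        c' * h ^ (q ^ (s + 0)) * \<theta> ^ (q ^ 2) - d' ^ (q ^ 2) * g ^ (q ^ (s + 0)) * \<theta> = 0 \<and>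
        c' * h ^ (q ^ 0) + d' * g ^ (q ^ (0 + 2)) = 0 \<and>
        c' * g ^ (q ^ (2 * s + 0)) * \<gamma> ^ (q ^ 0) + d' * h ^ (q ^ 0) * \<gamma> ^ (q ^ (0 + 2)) = 0"
      using e1 e2 e3 e4 by (simp add: B) (simp add: frob_def power2_eq_square)
    show ?thesis
      by (rule iffI[OF _ equiv], rule disjI2, rule disjI2, rule disjI2, rule conjI[OF opp(1)],
          rule exI[of _ c'], rule exI[of _ d'], rule exI[of _ g], rule exI[of _ h],
          rule bexI[OF _ id], rule bexI[of _ 0], rule sol) simp
  qed
qed

end
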